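(* Let $c_0,c_1,c_2$ be non-zero integers and let $n=3$ and $m_0=m_1=m_2=m_3=2$. Then $$N(\mathbb{P}^{2},\Delta;B)\gg B\log B$$ for all sufficiently large $B$, where the implied constant depends only on $c_0,c_1,c_2$.
   Context: A non-zero integer $x$ is called $2$-full (squareful) if $p^2\mid x$ for every prime $p$ dividing $x$. For $\mathbf{x}=(x_0,\dots,x_3)$ write $|\mathbf{x}|=\max_i|x_i|$. The counting function is $$N(\mathbb{P}^{2},\Delta;B)=\frac{1}{2}\#\left\{\mathbf{x}\in(\mathbb{Z}\setminus\{0\})^{4}: \gcd(x_0,x_1,x_2)=1,\ |\mathbf{x}|\leq B,\ x_i \text{ is } 2\text{-full for all } 0\leq i\leq 3,\ c_0x_0+c_1x_1+c_2x_2=x_3\right\}.$$ *)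

theory Defs
  imports Complex_Main "HOL-Computational_Algebra.Primes"
begin

definition two_full :: "int \<Rightarrow> bool" where
  "two_full x \<longleftrightarrow> x \<noteq> 0 \<and> (\<forall>p. prime p \<longrightarrow> p dvd x \<longrightarrow> p\<^sup>2 dvd x)"

definition campana_points :: "int \<Rightarrow> int \<Rightarrow> int \<Rightarrow> real \<Rightarrow> (int \<times> int \<times> int \<times> int) set" where
  "campana_points c0 c1 c2 B =
     {(x0, x1, x2, x3).
        x0 \<noteq> 0 \<and> x1 \<noteq> 0 \<and> x2 \<noteq> 0 \<and> x3 \<noteq> 0 \<and>
        Gcd {x0, x1, x2} = 1 \<and>
        real_of_int (Max {\<bar>x0\<bar>, \<bar>x1\<bar>, \<bar>x2\<bar>, \<bar>x3\<bar>}) \<le> B \<and>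
        two_full x0 \<and> two_full x1 \<and> two_full x2 \<and> two_full x3 \<and>
        c0 * x0 + c1 * x1 + c2 * x2 = x3}"

definition campana_count :: "int \<Rightarrow> int \<Rightarrow> int \<Rightarrow> real \<Rightarrow> real" where
  "campana_count c0 c1 c2 B = 1 / 2 * real (card (campana_points c0 c1 c2 B))"

text \<open>\<^const>\<open>card\<close> of an infinite set is 0; this does not interfere here.\<close>

lemma finite_campana_points: "finite (campana_points c0 c1 c2 B)"
proof (rule finite_subset)
  let ?I = "{- \<lfloor>B\<rfloor> .. \<lfloor>B\<rfloor>}"
  show "campana_points c0 c1 c2 B \<subseteq> ?I \<times> ?I \<times> ?I \<times> ?I"
    by (auto simp: campana_points_def le_floor_iff[symmetric] abs_le_iff)
  show "finite (?I \<times> ?I \<times> ?I \<times> ?I)"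
    by simp
qed

end

theory Submission
  imports Defs "HOL-Number_Theory.Cong"
begin

text \<open>
  The points \<open>x\<^sub>0 = A y\<^sub>0\<^sup>2 / (4 c\<^sub>0)\<close>, \<open>x\<^sub>1 = A m y\<^sub>1\<^sup>2 / (4 c\<^sub>1)\<close>, \<open>x\<^sub>2 = - A m y\<^sub>2\<^sup>2 / (4 c\<^sub>2)\<close>,
  \<open>x\<^sub>3 = A y\<^sub>3\<^sup>2 / 4\<close> satisfy the linear equation as soon as \<open>y\<close> lies on the split quadric
  \<open>y\<^sub>0\<^sup>2 + m y\<^sub>1\<^sup>2 = m y\<^sub>2\<^sup>2 + y\<^sub>3\<^sup>2\<close>, which is parametrised by
  \<open>y\<^sub>0, y\<^sub>3 = r u \<plusminus> m p q\<close> and \<open>y\<^sub>2, y\<^sub>1 = q u \<plusminus> p r\<close>.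
  The integers \<open>A\<close>, \<open>m\<close> and a residue class of \<open>(p, q, r, u)\<close> modulo some \<open>N\<close> can be chosen, prime by
  prime, so that all these points are integral, squareful and primitive whenever
  \<open>gcd(p, u) = gcd(q, r) = 1\<close>. Being split, the quadric has \<open>\<gg> X\<^sup>2 log X\<close> such points with
  \<open>max(p, u) max(q, r) \<le> X\<close>, each dyadic range of \<open>max(q, r)\<close> contributing \<open>\<gg> X\<^sup>2\<close>; finally
  \<open>B \<asymp> X\<^sup>2\<close>.
\<close>

section \<open>Counting coprime pairs in residue classes\<close>

text \<open>As \<open>N\<close> is invertible modulo \<open>l\<close>, the admissible
  \<open>i\<close> lie in a single class modulo \<open>l\<close>. Hence the quotient of
  \<open>i - a\<close> by \<open>l\<close> determines \<open>i\<close>, and it ranges over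
  \<open>{..T div l}\<close>.\<close>

lemma card_dvd_progression_le:
  fixes l N q a T :: nat
  assumes "coprime l N" "l > 0"
  shows "card {i \<in> {a..<a+T}. l dvd q + N * i} \<le> T div l + 1"
proof -
  let ?D = "{i \<in> {a..<a+T}. l dvd q + N * i}"
  have "inj_on (\<lambda>i. (i - a) div l) ?D"
  proof (rule inj_onI)
    fix i j assume i: "i \<in> ?D" and j: "j \<in> ?D" and eq: "(i - a) div l = (j - a) div l"
    have "[q + N * i = q + N * j] (mod l)"
      using i j by (simp add: cong_def)
    then have "[N * i = N * j] (mod l)"
      by (simp add: cong_add_lcancel_nat)
    then have "[i = j] (mod l)"
      using assms(1) by (simp add: cong_mult_lcancel_nat coprime_commute)
    then have "[(i - a) + a = (j - a) + a] (mod l)"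
      using i j by simp
    then have "[i - a = j - a] (mod l)"
      by (simp only: cong_add_rcancel_nat)
    then have "i - a = j - a"
      using eq by (metis cong_def div_mult_mod_eq)
    then show "i = j" using i j by auto
  qed
  moreover have "(\<lambda>i. (i - a) div l) ` ?D \<subseteq> {..T div l}"
    by (auto intro!: div_le_mono)
  ultimately have "card ?D \<le> card {..T div l}"
    by (intro card_inj_on_le) auto
  then show ?thesis by simp
qed

lemma sum_inverse_squares_from_7_le:
  "(\<Sum>l=7..n. 1 / (real l)\<^sup>2) \<le> 1/6"
proof -
  \<comment> \<open>The extra term \<open>- 1 / real n\<close> makes the induction work: each
    summand is dominated by a telescoping difference of reciprocals.\<close>
  have *: "(\<Sum>l=7..n. 1 / (real l)\<^sup>2) \<le> 1/6 - 1 / real n" if "n \<ge> 6" for n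
    using that
  proof (induction n rule: dec_induct)
    case base
    show ?case by simp
  next
    case (step n)
    have "1 / (real (Suc n))\<^sup>2 \<le> 1 / real n - 1 / real (Suc n)"
    proof -
      have "1 / (real (Suc n))\<^sup>2 \<le> 1 / (real n * real (Suc n))"
        using step.hyps by (intro divide_left_mono) (auto simp: power2_eq_square)
      also have "\<dots> = 1 / real n - 1 / real (Suc n)"
        using step.hyps by (simp add: field_simps)
      finally show ?thesis .
    qed
    moreover have "(\<Sum>l=7..Suc n. 1 / (real l)\<^sup>2) = (\<Sum>l=7..n. 1 / (real l)\<^sup>2) + 1 / (real (Suc n))\<^sup>2"
      using step.hyps by (subst sum.cl_ivl_Suc) simp
    ultimately show ?case using step.IH by linarith
  qed
  show ?thesis
  proof (cases "n \<ge> 6")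
    case True
    have "0 \<le> 1 / real n" by simp
    with *[OF True] show ?thesis by linarith
  qed auto
qed

text \<open>Sieve by a union bound: from all \<open>T^2\<close> pairs remove those with a common
  prime factor \<open>l\<close>. By \<open>cop\<close> such an \<open>l\<close> does not divide
  \<open>N\<close>, so \<open>l >= 7\<close>. Primes up to \<open>T\<close> cost at most
  \<open>4 T^2\<close> times the sum of \<open>1/l^2\<close>, hence \<open>2/3 T^2\<close>; larger
  primes cost at most \<open>2 N T <= T^2/6\<close>. This leaves \<open>T^2/6\<close>.\<close>

lemma card_coprime_progressions_ge:
  fixes N q r T :: nat
  assumes "30 dvd N" "N > 0" "q < N" "r < N" "T \<ge> 12 * N"
    and cop: "\<And>l. prime l \<Longrightarrow> l dvd N \<Longrightarrow> l dvd q \<Longrightarrow> \<not> l dvd r"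
  shows "real T ^ 2 / 6 \<le>
    real (card {(i, j). i \<in> {T..<2*T} \<and> j \<in> {T..<2*T} \<and> coprime (q + N * i) (r + N * j)})"
    (is "_ \<le> real (card ?G)")
proof -
  define I where "I = {T..<2*T}"
  define D where "D l s = {i \<in> I. l dvd s + N * i}" for l s
  \<comment> \<open>Larger primes cannot occur, since
    \<open>q + N * i < N * (i + 1) <= 2 * N * T\<close> for \<open>i\<close> in
    \<open>I\<close>.\<close>
  define L where "L = {l. prime l \<and> \<not> l dvd N \<and> l < 2 * N * T}"
  define L1 where "L1 = {l \<in> L. l \<le> T}"
  define L2 where "L2 = {l \<in> L. l > T}"
  have finL: "finite L" unfolding L_def by (rule finite_subset[of _ "{..<2*N*T}"]) auto
  have Lun: "L = L1 \<union> L2" "L1 \<inter> L2 = {}" by (auto simp: L1_def L2_def)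
  have finL12: "finite L1" "finite L2" using finL by (auto simp: L1_def L2_def)
  have finI: "finite I" and cardI: "card I = T" by (auto simp: I_def)
  have finD: "finite (D l s)" for l s using finI by (auto simp: D_def)
  have cardD: "card (D l s) \<le> T div l + 1" if "l \<in> L" for l s
  proof -
    have "coprime l N" using that prime_imp_coprime by (auto simp: L_def)
    moreover have "l > 0" using that prime_gt_0_nat by (auto simp: L_def)
    ultimately have "card {i \<in> {T..<T+T}. l dvd s + N * i} \<le> T div l + 1"
      by (rule card_dvd_progression_le)
    then show ?thesis by (simp add: D_def I_def mult_2)
  qed
  have cover: "I \<times> I \<subseteq> ?G \<union> (\<Union>l\<in>L. D l q \<times> D l r)"
  proof
    fix z assume z: "z \<in> I \<times> I"
    obtain i j where ij: "z = (i, j)" "i \<in> I" "j \<in> I" using z by auto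
    show "z \<in> ?G \<union> (\<Union>l\<in>L. D l q \<times> D l r)"
    proof (cases "coprime (q + N * i) (r + N * j)")
      case True
      then show ?thesis using ij by (auto simp: I_def)
    next
      case False
      then obtain l where l: "prime l" "l dvd q + N * i" "l dvd r + N * j"
        using prime_factor_nat[of "gcd (q + N * i) (r + N * j)"] by (auto simp: coprime_iff_gcd_eq_1)
      have "\<not> l dvd N"
      proof
        assume "l dvd N"
        then have "l dvd q" "l dvd r" using l
          by (simp_all add: dvd_add_left_iff)
        then show False using cop l(1) \<open>l dvd N\<close> by blast
      qed
      moreover have "l < 2 * N * T"
      proof -
        have T: "T > 0" using ij by (auto simp: I_def)
        then have "l \<le> q + N * i"
          using l(2) ij(2) assms(2) by (intro dvd_imp_le) (auto simp: I_def)
        also have "\<dots> < N + N * i" using assms by simp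
        also have "\<dots> = N * Suc i" by simp
        also have "\<dots> \<le> N * (2 * T)" using ij(2) by (intro mult_le_mono) (auto simp: I_def)
        finally show ?thesis by (simp add: mult_ac)
      qed
      ultimately have "l \<in> L" using l by (auto simp: L_def)
      then show ?thesis using l ij by (auto simp: D_def)
    qed
  qed
  have finG: "finite ?G" by (rule finite_subset[of _ "I \<times> I"]) (auto simp: I_def)
  have "T * T = card (I \<times> I)" by (simp add: card_cartesian_product cardI)
  also have "\<dots> \<le> card (?G \<union> (\<Union>l\<in>L. D l q \<times> D l r))"
    using cover finG finL finD by (intro card_mono) auto
  also have "\<dots> \<le> card ?G + card (\<Union>l\<in>L. D l q \<times> D l r)" by (rule card_Un_le)
  also have "card (\<Union>l\<in>L. D l q \<times> D l r) \<le> (\<Sum>l\<in>L. card (D l q \<times> D l r))"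
    using finL by (rule card_UN_le)
  also have "\<dots> = (\<Sum>l\<in>L. card (D l q) * card (D l r))"
    by (simp add: card_cartesian_product)
  also have "\<dots> = (\<Sum>l\<in>L1. card (D l q) * card (D l r)) + (\<Sum>l\<in>L2. card (D l q) * card (D l r))"
    unfolding Lun(1) using finL12 Lun(2) by (rule sum.union_disjoint)
  finally have main: "T * T \<le> card ?G +
    ((\<Sum>l\<in>L1. card (D l q) * card (D l r)) + (\<Sum>l\<in>L2. card (D l q) * card (D l r)))"
    by simp
  have s1: "real (\<Sum>l\<in>L1. card (D l q) * card (D l r)) \<le> 2/3 * real T ^ 2"
  proof -
    have each: "real (card (D l s)) \<le> 2 * real T / real l" if "l \<in> L1" for l s
    proof -
      have l: "l \<in> L" "l \<le> T" "l > 0" using that prime_gt_0_nat by (auto simp: L1_def L_def)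
      have "real (card (D l s)) \<le> real (T div l) + 1" using cardD[OF l(1), of s] by linarith
      also have "\<dots> \<le> real T / real l + 1" by (simp add: of_nat_div_le_of_nat)
      \<comment> \<open>The summand 1 is at most \<open>T / l\<close> because
        \<open>l <= T\<close>.\<close>
      also have "\<dots> \<le> 2 * real T / real l" using l by (simp add: field_simps)
      finally show ?thesis .
    qed
    have "real (\<Sum>l\<in>L1. card (D l q) * card (D l r)) = (\<Sum>l\<in>L1. real (card (D l q)) * real (card (D l r)))"
      by simp
    also have "\<dots> \<le> (\<Sum>l\<in>L1. (2 * real T / real l) * (2 * real T / real l))"
      by (intro sum_mono mult_mono each) auto
    also have "\<dots> = 4 * real T ^ 2 * (\<Sum>l\<in>L1. 1 / (real l)\<^sup>2)"
      by (simp add: sum_distrib_left power2_eq_square)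
    also have "(\<Sum>l\<in>L1. 1 / (real l)\<^sup>2) \<le> (\<Sum>l=7..T. 1 / (real l)\<^sup>2)"
    proof (rule sum_mono2)
      show "L1 \<subseteq> {7..T}"
      proof
        fix l assume "l \<in> L1"
        then have l: "prime l" "\<not> l dvd N" "l \<le> T" by (auto simp: L1_def L_def)
        have "l \<ge> 2" using l(1) prime_ge_2_nat by blast
        moreover have "\<not> l dvd 30" using l(2) assms(1) dvd_trans by blast
        then have "l \<noteq> 2" "l \<noteq> 3" "l \<noteq> 5" "l \<noteq> 6" by auto
        moreover have "l \<noteq> 4" using l(1) prime_nat_not_dvd[of 4 2] by auto
        ultimately have "l \<ge> 7" by linarith
        then show "l \<in> {7..T}" using l by auto
      qed
    qed auto
    also have "\<dots> \<le> 1/6" by (rule sum_inverse_squares_from_7_le)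
    finally show ?thesis by (simp add: mult_left_mono)
  qed
  have s2: "real (\<Sum>l\<in>L2. card (D l q) * card (D l r)) \<le> 2 * real N * real T"
  proof -
    have "(\<Sum>l\<in>L2. card (D l q) * card (D l r)) \<le> (\<Sum>l\<in>L2. 1)"
    proof (rule sum_mono)
      \<comment> \<open>Beyond \<open>T\<close> each progression has at most one term divisible by
        \<open>l\<close>, so each such prime removes at most one pair.\<close>
      fix l assume "l \<in> L2"
      then have "l \<in> L" "T div l = 0" by (auto simp: L2_def)
      then have "card (D l q) \<le> 1" "card (D l r) \<le> 1" using cardD[of l] by fastforce+
      then show "card (D l q) * card (D l r) \<le> 1" using mult_le_mono by fastforce
    qed
    also have "\<dots> = card L2" by simp
    also have "\<dots> \<le> card {..<2*N*T}" by (intro card_mono) (auto simp: L2_def L_def)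
    also have "\<dots> = 2 * N * T" by simp
    finally have "real (\<Sum>l\<in>L2. card (D l q) * card (D l r)) \<le> real (2 * N * T)"
      by (simp only: of_nat_le_iff)
    then show ?thesis by simp
  qed
  have "real T ^ 2 \<le> real (card ?G) + (2/3 * real T ^ 2 + 2 * real N * real T)"
    using main s1 s2 unfolding power2_eq_square of_nat_mult[symmetric] by linarith
  moreover have "2 * real N * real T \<le> real T ^ 2 / 6"
  proof -
    have "12 * real N \<le> real T" using assms(5) by linarith
    then have "12 * real N * real T \<le> real T * real T" by (intro mult_right_mono) auto
    then show ?thesis by (simp add: power2_eq_square)
  qed
  ultimately show ?thesis by linarith
qed

text \<open>The four product bounds together say \<open>max(p, u) * max(q, r) <= X\<close>; these
  are the products from which \<open>quadric_point\<close> is built.\<close>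

definition quads :: "nat \<Rightarrow> nat \<Rightarrow> nat \<Rightarrow> nat \<Rightarrow> nat \<Rightarrow> nat \<Rightarrow> (nat \<times> nat \<times> nat \<times> nat) set" where
  "quads N p0 q0 r0 u0 X = {(p, q, r, u).
     [p = p0] (mod N) \<and> [q = q0] (mod N) \<and> [r = r0] (mod N) \<and> [u = u0] (mod N) \<and>
     0 < p \<and> 0 < q \<and> 0 < r \<and> 0 < u \<and> coprime p u \<and> coprime q r \<and>
     p * q \<le> X \<and> p * r \<le> X \<and> q * u \<le> X \<and> r * u \<le> X}"

lemma finite_quads: "finite (quads N p0 q0 r0 u0 X)"
proof (rule finite_subset)
  have le: "a \<le> X" if "a * b \<le> X" "0 < b" for a b :: nat
    using that by (metis dual_order.trans mult_le_mono2 mult.right_neutral Suc_leI One_nat_def)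
  show "quads N p0 q0 r0 u0 X \<subseteq> {..X} \<times> {..X} \<times> {..X} \<times> {..X}"
    unfolding quads_def
    by (auto intro: le le[OF order.trans[OF eq_refl[OF mult.commute]]])
qed simp

text \<open>The logarithm comes from \<open>n + 1\<close> disjoint dyadic boxes. In box
  \<open>k\<close> the entries \<open>q, r\<close> have size about \<open>N * T k\<close> and
  \<open>p, u\<close> about \<open>N * T' k\<close>, with \<open>T k * T' k\<close> comparable to
  \<open>Y\<close>; the sieve applied to both pairs gives a multiple of \<open>Y^2\<close> for each
  box.\<close>

lemma card_quads_ge:
  fixes N p0 q0 r0 u0 Y n :: nat
  assumes N: "30 dvd N" "N > 0" and less: "p0 < N" "q0 < N" "r0 < N" "u0 < N"
    and cop_pu: "\<And>l. prime l \<Longrightarrow> l dvd N \<Longrightarrow> l dvd p0 \<Longrightarrow> \<not> l dvd u0"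
    and cop_qr: "\<And>l. prime l \<Longrightarrow> l dvd N \<Longrightarrow> l dvd q0 \<Longrightarrow> \<not> l dvd r0"
    and n: "(12 * N)\<^sup>2 * 2 ^ n \<le> Y"
  shows "real (Suc n) * (real Y)\<^sup>2 / 144 \<le> real (card (quads N p0 q0 r0 u0 (4 * N\<^sup>2 * Y)))"
proof -
  define G where "G T a b = {(i, j). i \<in> {T..<2*T} \<and> j \<in> {T..<2*T} \<and> coprime (a + N * i) (b + N * j)}"
    for T a b :: nat
  \<comment> \<open>The sieve requires lengths of at least \<open>12 * N\<close>; the hypothesis
    \<open>n\<close> ensures this for the complementary length \<open>T' k\<close> as well.\<close>
  define T where "T k = 12 * N * 2 ^ k" for k :: nat
  define T' where "T' k = Y div T k" for k
  define F where "F k = G (T k) q0 r0 \<times> G (T' k) p0 u0" for k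
  define h where "h = (\<lambda>((i, j), (i', j')). (p0 + N * i', q0 + N * i, r0 + N * j, u0 + N * j'))"
  have finG: "finite (G t a b)" for t a b
    by (rule finite_subset[of _ "{t..<2*t} \<times> {t..<2*t}"]) (auto simp: G_def)
  have T: "T k \<ge> 12 * N" for k by (simp add: T_def)
  have T': "T' k \<ge> 12 * N" if "k \<le> n" for k
  proof -
    have "12 * N * T k = (12 * N)\<^sup>2 * 2 ^ k" by (simp add: T_def power2_eq_square)
    also have "\<dots> \<le> (12 * N)\<^sup>2 * 2 ^ n" using that by (intro mult_le_mono2 power_increasing) auto
    also have "\<dots> \<le> Y" by (rule n)
    finally show ?thesis
      unfolding T'_def using N(2) by (simp add: less_eq_div_iff_mult_less_eq T_def)
  qed
  have cardF: "(real Y)\<^sup>2 / 144 \<le> real (card (F k))" if "k \<le> n" for k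
  proof -
    have Tpos: "T k > 0" using N(2) by (simp add: T_def)
    \<comment> \<open>Rounding down in \<open>T' k\<close> loses at most a factor 2. Squared it
      gives 4, and the two sieve densities \<open>1/6\<close> give 36, whence 144.\<close>
    have "Y < T k * (T' k + 1)"
      unfolding T'_def using Tpos by (metis Suc_eq_plus1 dividend_less_times_div mult_Suc_right)
    also have "\<dots> \<le> T k * (2 * T' k)" using T'[OF that] N(2) by (intro mult_le_mono2) linarith
    finally have "real Y \<le> 2 * (real (T k) * real (T' k))"
      by (metis (no_types, lifting) less_imp_le mult.left_commute of_nat_le_iff of_nat_mult of_nat_numeral)
    then have "(real Y)\<^sup>2 \<le> (2 * (real (T k) * real (T' k)))\<^sup>2"
      by (intro power_mono) auto
    then have "(real Y)\<^sup>2 / 144 \<le> (real (T k) ^ 2 / 6) * (real (T' k) ^ 2 / 6)"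
      by (simp add: power_mult_distrib)
    also have "\<dots> \<le> real (card (G (T k) q0 r0)) * real (card (G (T' k) p0 u0))"
      unfolding G_def
      by (intro mult_mono card_coprime_progressions_ge N less T T'[OF that] cop_pu cop_qr) auto
    also have "\<dots> = real (card (F k))"
      by (simp add: F_def card_cartesian_product)
    finally show ?thesis .
  qed
  have disj: "F k \<inter> F k' = {}" if "k \<noteq> k'" for k k'
  proof -
    have *: "F k \<inter> F k' = {}" if "k < k'" for k k'
    proof -
      \<comment> \<open>The range of \<open>i\<close> belonging to \<open>k\<close> ends before the
        one belonging to \<open>k'\<close> begins.\<close>
      have "2 * T k = 12 * N * 2 ^ Suc k" by (simp add: T_def)
      also have "\<dots> \<le> T k'" unfolding T_def using that by (intro mult_le_mono2 power_increasing) auto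
      finally show ?thesis by (auto simp: F_def G_def)
    qed
    show ?thesis using *[of k k'] *[of k' k] that by (metis Int_commute linorder_neqE_nat)
  qed
  have inj: "inj h" using N(2) by (auto simp: h_def inj_def)
  have sub: "h ` (\<Union>k\<le>n. F k) \<subseteq> quads N p0 q0 r0 u0 (4 * N\<^sup>2 * Y)"
  proof
    fix z assume "z \<in> h ` (\<Union>k\<le>n. F k)"
    then obtain k i j i' j' where k: "k \<le> n" and
      ij: "(i, j) \<in> G (T k) q0 r0" "(i', j') \<in> G (T' k) p0 u0"
      and z: "z = (p0 + N * i', q0 + N * i, r0 + N * j, u0 + N * j')"
      by (auto simp: F_def h_def)
    have ub: "a + N * i \<le> 2 * N * t" if "a < N" "i < 2 * t" for a i t
    proof -
      have "a + N * i \<le> N * Suc i" using that by simp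
      also have "\<dots> \<le> N * (2 * t)" using that by (intro mult_le_mono2) auto
      finally show ?thesis by (simp add: mult_ac)
    qed
    have le: "a * b \<le> 4 * N\<^sup>2 * Y" if "a \<le> 2 * N * T k" "b \<le> 2 * N * T' k" for a b
    proof -
      have "a * b \<le> (2 * N * T k) * (2 * N * T' k)" using that by (intro mult_le_mono)
      also have "\<dots> = 4 * N\<^sup>2 * (T k * T' k)" by (simp add: power2_eq_square)
      also have "\<dots> \<le> 4 * N\<^sup>2 * Y" unfolding T'_def by (intro mult_le_mono2) simp
      finally show ?thesis .
    qed
    have pos: "i > 0" "j > 0" "i' > 0" "j' > 0"
      using ij T[of k] T'[OF k] N(2) by (auto simp: G_def)
    have q: "q0 + N * i \<le> 2 * N * T k" and r: "r0 + N * j \<le> 2 * N * T k"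
      and p: "p0 + N * i' \<le> 2 * N * T' k" and u: "u0 + N * j' \<le> 2 * N * T' k"
      using ij less by (auto simp: G_def intro!: ub)
    show "z \<in> quads N p0 q0 r0 u0 (4 * N\<^sup>2 * Y)"
      using le[OF q p] le[OF q u] le[OF r p] le[OF r u] ij pos N(2)
      unfolding z quads_def by (simp add: G_def cong_def mult.commute)
  qed
  have "real (Suc n) * (real Y)\<^sup>2 / 144 = (\<Sum>k\<le>n. (real Y)\<^sup>2 / 144)" by simp
  also have "\<dots> \<le> (\<Sum>k\<le>n. real (card (F k)))" by (intro sum_mono cardF) auto
  also have "\<dots> = real (card (\<Union>k\<le>n. F k))"
    using disj finG by (subst card_UN_disjoint) (auto simp: F_def)
  also have "card (\<Union>k\<le>n. F k) = card (h ` (\<Union>k\<le>n. F k))"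
    using inj by (intro card_image[symmetric]) (auto intro: inj_on_subset)
  also have "real \<dots> \<le> real (card (quads N p0 q0 r0 u0 (4 * N\<^sup>2 * Y)))"
    using card_mono[OF finite_quads sub] by simp
  finally show ?thesis .
qed

section \<open>Local conditions for squareful points\<close>

lemma chinese_remainder_prime_powers:
  fixes S :: "int set" and f :: "int \<Rightarrow> int"
  assumes "finite S" "\<And>l. l \<in> S \<Longrightarrow> prime l"
  shows "\<exists>x. \<forall>l\<in>S. [x = f l] (mod l ^ K)"
  using assms
proof (induction S rule: finite_induct)
  case (insert a S)
  then obtain x where x: "\<forall>l\<in>S. [x = f l] (mod l ^ K)" by auto
  have "coprime (a ^ K) (\<Prod>l\<in>S. l ^ K)"
  proof (rule prod_coprime_right)
    fix l assume "l \<in> S"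
    then have "coprime a l" using insert.hyps insert.prems by (intro primes_coprime) auto
    then show "coprime (a ^ K) (l ^ K)" by simp
  qed
  then obtain z where z: "[z = f a] (mod a ^ K)" "[z = x] (mod (\<Prod>l\<in>S. l ^ K))"
    using binary_chinese_remainder_int by blast
  have "[z = f l] (mod l ^ K)" if "l \<in> S" for l
  proof -
    have "l ^ K dvd (\<Prod>l\<in>S. l ^ K)" using that insert.hyps by (intro dvd_prodI) auto
    then have "[z = x] (mod l ^ K)" using z(2) cong_dvd_modulus by blast
    with x that show ?thesis using cong_trans by blast
  qed
  with z show ?case by auto
qed auto

text \<open>Divisibility by \<open>l ^ n\<close> is preserved for \<open>n <= K\<close>. The bound
  on \<open>multiplicity l z\<close> is strict so that the next exponent, at which divisibility
  fails, is still covered.\<close>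

lemma multiplicity_cong_prime_power:
  fixes l y z :: int
  assumes "prime l" "[y = z] (mod l ^ K)" "z \<noteq> 0" "multiplicity l z < K"
  shows "multiplicity l y = multiplicity l z"
proof -
  have iff: "l ^ n dvd y \<longleftrightarrow> l ^ n dvd z" if "n \<le> K" for n
  proof -
    have "[y = z] (mod l ^ n)" using assms(2) that le_imp_power_dvd cong_dvd_modulus by blast
    then show ?thesis by (rule cong_dvd_iff)
  qed
  show ?thesis
  proof (rule multiplicity_eqI)
    show "l ^ multiplicity l z dvd y" using iff[of "multiplicity l z"] assms(4) by (simp add: multiplicity_dvd)
    have "\<not> l ^ Suc (multiplicity l z) dvd z"
      using assms(1,3) by (subst power_dvd_iff_le_multiplicity) (auto simp: prime_elem_not_unit)
    then show "\<not> l ^ Suc (multiplicity l z) dvd y" using iff[of "Suc (multiplicity l z)"] assms(4) by simp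
  qed
qed

lemma multiplicity_ge_of_cong_0:
  fixes l y :: int
  assumes "prime l" "[y = 0] (mod l ^ K)" "y \<noteq> 0"
  shows "K \<le> multiplicity l y"
  using assms by (intro multiplicity_geI) (auto simp: cong_0_iff)

text \<open>A non-zero integer is squareful exactly when no prime has multiplicity 1 in it, and
  \<open>e\<close> is the multiplicity of the quotient. The multiplicities of \<open>x\<close> are
  returned for the later check of primitivity.\<close>

lemma two_full_quotient:
  fixes a b :: int
  assumes "a \<noteq> 0" "b \<noteq> 0"
    and "\<And>l::int. prime l \<Longrightarrow> \<exists>e. multiplicity l b = multiplicity l a + e \<and> e \<noteq> 1"
  shows "\<exists>x. b = a * x \<and> two_full x \<and>
    (\<forall>l. prime l \<longrightarrow> multiplicity l b = multiplicity l a + multiplicity l x)"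
proof -
  have "a dvd b"
  proof (rule multiplicity_le_imp_dvd)
    fix l :: int assume "prime l"
    from assms(3)[OF this] show "multiplicity l a \<le> multiplicity l b" by auto
  qed (use assms in auto)
  then obtain x where x: "b = a * x" by blast
  then have x0: "x \<noteq> 0" using assms by auto
  have mult: "multiplicity l b = multiplicity l a + multiplicity l x" if "prime l" for l
    unfolding x using that assms x0 by (intro prime_elem_multiplicity_mult_distrib) auto
  have "l\<^sup>2 dvd x" if l: "prime l" "l dvd x" for l
  proof -
    have "multiplicity l x \<noteq> 1" using assms(3)[OF l(1)] mult[OF l(1)] by auto
    moreover have "multiplicity l x > 0" using prime_multiplicity_gt_zero_iff[OF prime_imp_prime_elem[OF l(1)] x0] l(2) by blast
    ultimately show ?thesis by (intro multiplicity_dvd') simp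
  qed
  then have "two_full x" using x0 by (simp add: two_full_def)
  with x mult show ?thesis by blast
qed

text \<open>Denominators are cleared, so that integrality of the \<open>x\<close>-coordinates is
  part of the relation. For non-zero \<open>A\<close> and \<open>m\<close> the
  \<open>y\<close>-coordinates are determined up to sign.\<close>

fun campana_lift :: "int \<Rightarrow> int \<Rightarrow> int \<Rightarrow> int \<Rightarrow> int \<Rightarrow>
    int \<times> int \<times> int \<times> int \<Rightarrow> int \<times> int \<times> int \<times> int \<Rightarrow> bool" where
  "campana_lift c0 c1 c2 A m (y0, y1, y2, y3) (x0, x1, x2, x3) \<longleftrightarrow>
     A * y0\<^sup>2 = 4 * c0 * x0 \<and> A * m * y1\<^sup>2 = 4 * c1 * x1 \<and>
     - (A * m * y2\<^sup>2) = 4 * c2 * x2 \<and> A * y3\<^sup>2 = 4 * x3 \<and>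
     two_full x0 \<and> two_full x1 \<and> two_full x2 \<and> two_full x3 \<and> Gcd {x0, x1, x2} = 1 \<and>
     c0 * x0 + c1 * x1 + c2 * x2 = x3"

fun quadric_point :: "int \<Rightarrow> int \<times> int \<times> int \<times> int \<Rightarrow> int \<times> int \<times> int \<times> int" where
  "quadric_point m (p, q, r, u) = (r * u + m * p * q, q * u - p * r, q * u + p * r, r * u - m * p * q)"

text \<open>The exponents \<open>e\<^sub>i\<close> are the valuations at \<open>l\<close> of the coordinates of the Campana point.\<close>

lemma campana_point_of_local_conditions:
  fixes A m y0 y1 y2 y3 c0 c1 c2 :: int
  assumes nz: "A \<noteq> 0" "m \<noteq> 0" "y0 \<noteq> 0" "y1 \<noteq> 0" "y2 \<noteq> 0" "y3 \<noteq> 0" "c0 \<noteq> 0" "c1 \<noteq> 0" "c2 \<noteq> 0"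
    and quadric: "y0\<^sup>2 + m * y1\<^sup>2 - m * y2\<^sup>2 = y3\<^sup>2"
    and loc: "\<And>l. prime l \<Longrightarrow> \<exists>e0 e1 e2 e3.
       multiplicity l A + 2 * multiplicity l y0 = multiplicity l 4 + multiplicity l c0 + e0 \<and>
       multiplicity l A + multiplicity l m + 2 * multiplicity l y1 = multiplicity l 4 + multiplicity l c1 + e1 \<and>
       multiplicity l A + multiplicity l m + 2 * multiplicity l y2 = multiplicity l 4 + multiplicity l c2 + e2 \<and>
       multiplicity l A + 2 * multiplicity l y3 = multiplicity l 4 + e3 \<and>
       e0 \<noteq> 1 \<and> e1 \<noteq> 1 \<and> e2 \<noteq> 1 \<and> e3 \<noteq> 1 \<and> (e0 = 0 \<or> e1 = 0 \<or> e2 = 0)"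
  shows "\<exists>x0 x1 x2 x3. campana_lift c0 c1 c2 A m (y0, y1, y2, y3) (x0, x1, x2, x3)"
proof -
  have m2: "multiplicity l (A * y\<^sup>2) = multiplicity l A + 2 * multiplicity l y"
    and m3: "multiplicity l (A * m * y\<^sup>2) = multiplicity l A + multiplicity l m + 2 * multiplicity l y"
    and m3': "multiplicity l (- (A * m * y\<^sup>2)) = multiplicity l A + multiplicity l m + 2 * multiplicity l y"
    and m4: "multiplicity l (4 * c) = multiplicity l 4 + multiplicity l c"
    if "prime l" "y \<noteq> 0" "c \<noteq> 0" for l y c :: int
  proof -
    have [simp]: "multiplicity l (- z) = multiplicity l z" for z
      using multiplicity_times_unit_right[of "-1" l z] by simp
    show "multiplicity l (A * y\<^sup>2) = multiplicity l A + 2 * multiplicity l y"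
      "multiplicity l (A * m * y\<^sup>2) = multiplicity l A + multiplicity l m + 2 * multiplicity l y"
      "multiplicity l (- (A * m * y\<^sup>2)) = multiplicity l A + multiplicity l m + 2 * multiplicity l y"
      "multiplicity l (4 * c) = multiplicity l 4 + multiplicity l c"
      using that(2,3) nz prime_imp_prime_elem[OF that(1)]
      by (simp_all add: prime_elem_multiplicity_mult_distrib prime_elem_multiplicity_power_distrib)
  qed
  have "\<exists>e. multiplicity l (A * y0\<^sup>2) = multiplicity l (4 * c0) + e \<and> e \<noteq> 1" if "prime l" for l
    using loc[OF that] nz that by (auto simp: m2 m4)
  then obtain x0 where x0: "A * y0\<^sup>2 = 4 * c0 * x0" "two_full x0"
    "\<And>l. prime l \<Longrightarrow> multiplicity l (A * y0\<^sup>2) = multiplicity l (4 * c0) + multiplicity l x0"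
    using two_full_quotient[of "4 * c0" "A * y0\<^sup>2"] nz by auto
  have "\<exists>e. multiplicity l (A * m * y1\<^sup>2) = multiplicity l (4 * c1) + e \<and> e \<noteq> 1" if "prime l" for l
    using loc[OF that] nz that by (auto simp: m3 m4)
  then obtain x1 where x1: "A * m * y1\<^sup>2 = 4 * c1 * x1" "two_full x1"
    "\<And>l. prime l \<Longrightarrow> multiplicity l (A * m * y1\<^sup>2) = multiplicity l (4 * c1) + multiplicity l x1"
    using two_full_quotient[of "4 * c1" "A * m * y1\<^sup>2"] nz by auto
  have "\<exists>e. multiplicity l (- (A * m * y2\<^sup>2)) = multiplicity l (4 * c2) + e \<and> e \<noteq> 1" if "prime l" for l
    using loc[OF that] nz that by (auto simp: m3' m4)
  then obtain x2 where x2: "- (A * m * y2\<^sup>2) = 4 * c2 * x2" "two_full x2"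
    "\<And>l. prime l \<Longrightarrow> multiplicity l (- (A * m * y2\<^sup>2)) = multiplicity l (4 * c2) + multiplicity l x2"
    using two_full_quotient[of "4 * c2" "- (A * m * y2\<^sup>2)"] nz by auto
  have "\<exists>e. multiplicity l (A * y3\<^sup>2) = multiplicity l (4) + e \<and> e \<noteq> 1" if "prime l" for l
    using loc[OF that] nz that by (auto simp: m2)
  then obtain x3 where x3: "A * y3\<^sup>2 = 4 * x3" "two_full x3"
    "\<And>l. prime l \<Longrightarrow> multiplicity l (A * y3\<^sup>2) = multiplicity l (4) + multiplicity l x3"
    using two_full_quotient[of "4" "A * y3\<^sup>2"] nz by auto
  have "Gcd {x0, x1, x2} = 1"
  \<comment> \<open>A common prime factor would make \<open>e0\<close>, \<open>e1\<close> and
    \<open>e2\<close> all positive, against the last clause of \<open>loc\<close>.\<close>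
  proof (rule ccontr)
    assume g: "Gcd {x0, x1, x2} \<noteq> 1"
    have "x0 \<noteq> 0" "x1 \<noteq> 0" "x2 \<noteq> 0" using x0 x1 x2 by (auto simp: two_full_def)
    have "\<not> is_unit (Gcd {x0, x1, x2})" using g Gcd_int_greater_eq_0[of "{x0, x1, x2}"] by (simp only: zdvd1_eq)
    moreover have "Gcd {x0, x1, x2} \<noteq> 0" using \<open>x0 \<noteq> 0\<close> by auto
    ultimately obtain l where l: "prime l" "l dvd Gcd {x0, x1, x2}"
      using prime_divisor_exists by blast
    then have "l dvd x0" "l dvd x1" "l dvd x2" by (auto simp: dvd_Gcd_iff)
    then have "multiplicity l x0 > 0" "multiplicity l x1 > 0" "multiplicity l x2 > 0"
      using \<open>x0 \<noteq> 0\<close> \<open>x1 \<noteq> 0\<close> \<open>x2 \<noteq> 0\<close> prime_multiplicity_gt_zero_iff[OF prime_imp_prime_elem[OF l(1)]]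
      by blast+
    with loc[OF l(1)] x0(3)[OF l(1)] x1(3)[OF l(1)] x2(3)[OF l(1)] nz l(1) show False
      by (auto simp: m2 m3 m3' m4)
  qed
  moreover have "c0 * x0 + c1 * x1 + c2 * x2 = x3"
  proof -
    have "4 * (c0 * x0 + c1 * x1 + c2 * x2) = A * y0\<^sup>2 + A * m * y1\<^sup>2 - A * m * y2\<^sup>2"
      using x0(1) x1(1) x2(1) by (simp add: algebra_simps)
    also have "\<dots> = A * (y0\<^sup>2 + m * y1\<^sup>2 - m * y2\<^sup>2)" by (simp add: algebra_simps)
    also have "\<dots> = 4 * x3" using quadric x3(1) by simp
    finally show ?thesis by simp
  qed
  ultimately show ?thesis using x0(1,2) x1(1,2) x2(1,2) x3(1,2) unfolding campana_lift.simps by blast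
qed

text \<open>A quantifier-free form of the local condition: "equal or at least 2 more" encodes
  \<open>e\<close> different from 1 and guarantees that the subtractions of naturals used as
  witnesses are not truncated.\<close>

lemma valuation_witness:
  fixes a m c c0 c1 c2 y0 y1 y2 y3 :: nat
  assumes "a + 2 * y0 = c + c0 \<or> a + 2 * y0 \<ge> c + c0 + 2"
    and "a + m + 2 * y1 = c + c1 \<or> a + m + 2 * y1 \<ge> c + c1 + 2"
    and "a + m + 2 * y2 = c + c2 \<or> a + m + 2 * y2 \<ge> c + c2 + 2"
    and "a + 2 * y3 = c \<or> a + 2 * y3 \<ge> c + 2"
    and "a + 2 * y0 = c + c0 \<or> a + m + 2 * y1 = c + c1 \<or> a + m + 2 * y2 = c + c2"
  shows "\<exists>e0 e1 e2 e3. a + 2 * y0 = c + c0 + e0 \<and> a + m + 2 * y1 = c + c1 + e1 \<and>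
    a + m + 2 * y2 = c + c2 + e2 \<and> a + 2 * y3 = c + e3 \<and>
    e0 \<noteq> 1 \<and> e1 \<noteq> 1 \<and> e2 \<noteq> 1 \<and> e3 \<noteq> 1 \<and> (e0 = 0 \<or> e1 = 0 \<or> e2 = 0)"
  by (rule exI[of _ "a + 2 * y0 - (c + c0)"], rule exI[of _ "a + m + 2 * y1 - (c + c1)"],
      rule exI[of _ "a + m + 2 * y2 - (c + c2)"], rule exI[of _ "a + 2 * y3 - c"])
     (use assms in linarith)

text \<open>Sums and differences of the coordinates show that \<open>l\<close> divides
  \<open>r u\<close>, \<open>p q\<close>, \<open>q u\<close> and \<open>p r\<close>. If
  \<open>l\<close> does not divide \<open>p\<close>, it divides both \<open>q\<close> and
  \<open>r\<close>; if it does not divide \<open>u\<close>, the same follows. Either way coprimality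
  is violated.\<close>

lemma prime_dvd_quadric_point:
  fixes l m p q r u :: int
  assumes "prime l" "\<not> l dvd 2" "\<not> l dvd m" "coprime p u" "coprime q r"
    and "l dvd r * u + m * p * q" "l dvd q * u - p * r" "l dvd q * u + p * r"
    and "l dvd r * u - m * p * q"
  shows False
proof -
  have "l dvd (r * u + m * p * q) + (r * u - m * p * q)" by (rule dvd_add[OF assms(6,9)])
  then have "l dvd 2 * (r * u)" by (simp add: algebra_simps)
  then have ru: "l dvd r \<or> l dvd u" using assms by (simp add: prime_dvd_mult_iff)
  have "l dvd (r * u + m * p * q) - (r * u - m * p * q)" by (rule dvd_diff[OF assms(6,9)])
  then have "l dvd 2 * (m * (p * q))" by (simp add: algebra_simps)
  then have pq: "l dvd p \<or> l dvd q" using assms by (simp add: prime_dvd_mult_iff)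
  have "l dvd (q * u + p * r) + (q * u - p * r)" by (rule dvd_add[OF assms(8,7)])
  then have "l dvd 2 * (q * u)" by (simp add: algebra_simps)
  then have qu: "l dvd q \<or> l dvd u" using assms by (simp add: prime_dvd_mult_iff)
  have "l dvd (q * u + p * r) - (q * u - p * r)" by (rule dvd_diff[OF assms(8,7)])
  then have "l dvd 2 * (p * r)" by (simp add: algebra_simps)
  then have pr: "l dvd p \<or> l dvd r" using assms by (simp add: prime_dvd_mult_iff)
  have "\<not> (l dvd p \<and> l dvd u)" "\<not> (l dvd q \<and> l dvd r)"
    using assms(1,4,5) coprime_common_divisor not_prime_unit by blast+
  with ru pq qu pr show False by blast
qed

text \<open>Local choices at finitely many primes are glued by the Chinese remainder theorem; at all
  other primes the coprimality of the parameters suffices. The residue \<open>u0\<close> is 1, which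
  makes its condition automatic.\<close>

lemma exists_campana_family:
  fixes c0 c1 c2 :: int
  assumes nz: "c0 \<noteq> 0" "c1 \<noteq> 0" "c2 \<noteq> 0"
  obtains A m M p0 q0 r0 u0 :: int
  where "A \<noteq> 0" "m \<noteq> 0" "M > 0" "30 dvd M"
    "\<And>l. prime l \<Longrightarrow> l dvd M \<Longrightarrow> l dvd p0 \<Longrightarrow> \<not> l dvd u0"
    "\<And>l. prime l \<Longrightarrow> l dvd M \<Longrightarrow> l dvd q0 \<Longrightarrow> \<not> l dvd r0"
    "\<And>p q r u. [p = p0] (mod M) \<Longrightarrow> [q = q0] (mod M) \<Longrightarrow> [r = r0] (mod M) \<Longrightarrow> [u = u0] (mod M) \<Longrightarrow>
      coprime p u \<Longrightarrow> coprime q r \<Longrightarrow> \<exists>x. campana_lift c0 c1 c2 A m (quadric_point m (p, q, r, u)) x"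
proof -
  define v :: "int \<Rightarrow> int \<Rightarrow> nat" where "v = multiplicity"
  define S where "S = prime_factors (30 * c0 * c1 * c2)"
  have S_iff: "l \<in> S \<longleftrightarrow> prime l \<and> l dvd 30 * c0 * c1 * c2" for l
    using nz by (auto simp: S_def in_prime_factors_iff)
  have finS: "finite S" by (simp add: S_def)
  have primeS: "prime l" if "l \<in> S" for l using that S_iff by blast
  have S235: "2 \<in> S" "3 \<in> S" "5 \<in> S"
  proof -
    have "l \<in> S" if "prime l" "l dvd 30" for l
      using that dvd_mult2[OF that(2), of "c0 * c1 * c2"] by (simp add: S_iff mult.assoc)
    then show "2 \<in> S" "3 \<in> S" "5 \<in> S" by simp_all
  qed
  have v0: "v l z = 0" if "\<not> l dvd z" for l z
    unfolding v_def using that by (rule not_dvd_imp_multiplicity_0)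
  have outS: "v l c0 = 0" "v l c1 = 0" "v l c2 = 0" "v l 4 = 0" "v l 2 = 0" "\<not> l dvd 2"
    if "prime l" "l \<notin> S" for l
  proof -
    have nd: "\<not> l dvd 30" "\<not> l dvd c0" "\<not> l dvd c1" "\<not> l dvd c2"
      using that S_iff dvd_mult dvd_mult2 by metis+
    have "(2::int) dvd 30" "(2::int)\<^sup>2 = 4" by simp_all
    then have "\<not> l dvd 2" "\<not> l dvd 4"
      using nd(1) dvd_trans prime_dvd_power[OF that(1)] by metis+
    then show "v l c0 = 0" "v l c1 = 0" "v l c2 = 0" "v l 4 = 0" "v l 2 = 0" "\<not> l dvd 2"
      using nd v0 by blast+
  qed
  have v4: "v l 4 = 2 * v l 2" if "prime l" for l
    using prime_elem_multiplicity_power_distrib[OF prime_imp_prime_elem[OF that], of 2 2]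
    by (simp add: v_def)
  \<comment> \<open>\<open>K\<close> exceeds every valuation in play, so that a coordinate congruent
    to 0 modulo \<open>l ^ K\<close> never obstructs, and the non-zero residues keep their
    valuation.\<close>
  define K where "K = 5 + (\<Sum>l\<in>S. v l c0 + v l c1 + v l c2 + v l 4)"
  have K: "v l c0 + v l c1 + v l c2 + v l 4 + 5 \<le> K" if "l \<in> S" for l
    using member_le_sum[OF that, of "\<lambda>l. v l c0 + v l c1 + v l c2 + v l 4"] finS
    by (simp add: K_def)
  have K5: "K \<ge> 5" by (simp add: K_def)
  txt \<open>
    At a prime \<open>l\<close> dividing \<open>30 c\<^sub>0 c\<^sub>1 c\<^sub>2\<close>, two of the four coordinates \<open>y\<^sub>i\<close> are made highly
    divisible by \<open>l\<close> and the other two balance each other, so that one of \<open>x\<^sub>0\<close>, \<open>x\<^sub>1\<close>, \<open>x\<^sub>2\<close> is a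
    unit and no valuation equals 1. The balancing pair is \<open>(y\<^sub>0, y\<^sub>3)\<close> if \<open>v(c\<^sub>0) \<noteq> 1\<close>; otherwise
    \<open>(y\<^sub>1, y\<^sub>3)\<close> if \<open>v(c\<^sub>1) \<noteq> 1\<close>; otherwise \<open>(y\<^sub>2, y\<^sub>3)\<close> if \<open>v(c\<^sub>2) \<noteq> 1\<close>, which needs \<open>m = -1\<close>
    locally; and \<open>(y\<^sub>1, y\<^sub>2)\<close> if all three valuations are 1.
  \<close>
  define f where "f l = (if v l c0 \<noteq> 1 then v l 4 + v l c0 else if v l c1 \<noteq> 1 then v l c1
    else if v l c2 \<noteq> 1 then v l c2 else v l 4 + 1)" for l
  define A where "A = (\<Prod>l\<in>S. l ^ f l)"
  have vA: "v l A = (if l \<in> S then f l else 0)" if "prime l" for l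
    unfolding v_def A_def using finS primeS that by (intro multiplicity_prod_prime_powers)
  have A: "A \<noteq> 0" using finS primeS[of 0] by (auto simp: A_def)
  define m\<^sub>l where "m\<^sub>l l = (if v l c0 = 1 \<and> v l c1 = 1 \<and> v l c2 \<noteq> 1 then -1 else 1 :: int)" for l
  obtain m where m: "\<And>l. l \<in> S \<Longrightarrow> [m = m\<^sub>l l] (mod l ^ K)"
    using chinese_remainder_prime_powers[OF finS primeS] by blast
  have mS: "\<not> l dvd m" if "l \<in> S" for l
  proof
    assume "l dvd m"
    have "[m = m\<^sub>l l] (mod l)" using m[OF that] K5 by (rule_tac cong_dvd_modulus) auto
    with \<open>l dvd m\<close> have "l dvd m\<^sub>l l" using cong_dvd_iff by blast
    then show False using primeS[OF that] not_prime_unit by (auto simp: m\<^sub>l_def split: if_splits)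
  qed
  have m0: "m \<noteq> 0" using mS[OF S235(1)] by auto
  txt \<open>An auxiliary prime \<open>a\<close> at which all \<open>y\<^sub>i\<close> are units; it ensures \<open>y\<^sub>i \<noteq> 0\<close>.\<close>
  obtain b :: nat where b: "prime b" "b > nat \<bar>30 * c0 * c1 * c2 * m\<bar>" using bigger_prime by blast
  define a where "a = int b"
  have a: "prime a" "\<not> a dvd 30 * c0 * c1 * c2 * m"
  proof -
    show "prime a" using b by (simp add: a_def)
    have "\<bar>30 * c0 * c1 * c2 * m\<bar> < a" using b(2) by (simp add: a_def)
    then show "\<not> a dvd 30 * c0 * c1 * c2 * m"
      using nz m0 dvd_imp_le_int[of "30 * c0 * c1 * c2 * m" a] by fastforce
  qed
  have aS: "a \<notin> S" and am: "\<not> a dvd m" using a(2) S_iff dvd_mult dvd_mult2 by metis+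
  \<comment> \<open>Prescribing \<open>m\<close> at the primes of \<open>S\<close> leaves its other
    prime factors uncontrolled. They enter \<open>x1\<close> and \<open>x2\<close>, so the
    parameters need residues there too.\<close>
  define S' where "S' = insert a (S \<union> prime_factors m)"
  have finS': "finite S'" using finS by (simp add: S'_def)
  have primeS': "prime l" if "l \<in> S'" for l using that primeS a by (auto simp: S'_def)
  \<comment> \<open>With \<open>u = 1\<close>, the triple \<open>(p, q, r)\<close> is
    \<open>(1, 1, 0)\<close> at \<open>a\<close> and otherwise \<open>(0, 0, 1)\<close>,
    \<open>(1, -1, 1)\<close>, \<open>(1, 1, 1)\<close>, \<open>(0, 1, 0)\<close> in the four cases
    above. Primes outside \<open>S\<close> other than \<open>a\<close> have
    \<open>v l c0 = 0\<close> and so fall under the first case.\<close>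
  define p\<^sub>l :: "int \<Rightarrow> int" where
    "p\<^sub>l l = (if l = a \<or> v l c0 = 1 \<and> (v l c1 \<noteq> 1 \<or> v l c2 \<noteq> 1) then 1 else 0)" for l
  define q\<^sub>l :: "int \<Rightarrow> int" where
    "q\<^sub>l l = (if l = a then 1 else if v l c0 = 1 then (if v l c1 \<noteq> 1 then -1 else 1) else 0)" for l
  define r\<^sub>l :: "int \<Rightarrow> int" where
    "r\<^sub>l l = (if l = a \<or> v l c0 = 1 \<and> v l c1 = 1 \<and> v l c2 = 1 then 0 else 1)" for l
  obtain p0 where p0: "\<And>l. l \<in> S' \<Longrightarrow> [p0 = p\<^sub>l l] (mod l ^ K)"
    using chinese_remainder_prime_powers[OF finS' primeS'] by blast
  obtain q0 where q0: "\<And>l. l \<in> S' \<Longrightarrow> [q0 = q\<^sub>l l] (mod l ^ K)"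
    using chinese_remainder_prime_powers[OF finS' primeS'] by blast
  obtain r0 where r0: "\<And>l. l \<in> S' \<Longrightarrow> [r0 = r\<^sub>l l] (mod l ^ K)"
    using chinese_remainder_prime_powers[OF finS' primeS'] by blast
  define M where "M = (\<Prod>l\<in>S'. l ^ K)"
  have M: "M > 0" unfolding M_def by (intro prod_pos zero_less_power prime_gt_0_int primeS')
  have dvdM: "l ^ K dvd M" if "l \<in> S'" for l unfolding M_def using that finS' by (intro dvd_prodI)
  have dvdM1: "l dvd M" if "l \<in> S'" for l
    using dvd_trans[OF _ dvdM[OF that]] K5 by (simp add: dvd_power)
  have M30: "30 dvd M"
  proof -
    have "2 dvd M" "3 dvd M" "5 dvd M" using S235 dvdM1 by (auto simp: S'_def)
    then show ?thesis by presburger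
  qed
  have inS': "l \<in> S'" if l: "prime l" "l dvd M" for l
  proof -
    obtain l' where "l' \<in> S'" "l dvd l' ^ K"
      using l finS' by (auto simp: M_def prime_dvd_prod_iff)
    then have "l dvd l'" using l(1) prime_dvd_power by blast
    then show ?thesis using l(1) primeS' \<open>l' \<in> S'\<close> primes_dvd_imp_eq by blast
  qed
  have res_dvd: "l dvd z \<longleftrightarrow> l dvd w" if "[z = w] (mod l ^ K)" for l z w :: int
  proof -
    have "[z = w] (mod l)" using that K5 by (rule_tac cong_dvd_modulus) auto
    then show ?thesis by (rule cong_dvd_iff)
  qed
  have fam: "\<exists>x. campana_lift c0 c1 c2 A m (quadric_point m (p, q, r, u)) x"
    if p: "[p = p0] (mod M)" and q: "[q = q0] (mod M)" and r: "[r = r0] (mod M)" and u: "[u = 1] (mod M)"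
      and cop: "coprime p u" "coprime q r" for p q r u
  proof -
    define y0 y1 y2 y3 where y: "y0 = r * u + m * p * q" "y1 = q * u - p * r"
      "y2 = q * u + p * r" "y3 = r * u - m * p * q"
    have lcong: "[p = p\<^sub>l l] (mod l ^ K)" "[q = q\<^sub>l l] (mod l ^ K)" "[r = r\<^sub>l l] (mod l ^ K)"
      "[u = 1] (mod l ^ K)" if "l \<in> S'" for l
      using p q r u p0[OF that] q0[OF that] r0[OF that] dvdM[OF that]
      by (meson cong_dvd_modulus cong_trans)+
    \<comment> \<open>The residue \<open>z\<close> of \<open>m\<close> is left free: it is
      \<open>m\<^sub>l l\<close> at primes of \<open>S\<close> and \<open>m\<close> itself elsewhere
      in \<open>S'\<close>.\<close>
    have ycong: "[y0 = r\<^sub>l l + z * p\<^sub>l l * q\<^sub>l l] (mod l ^ K)" "[y1 = q\<^sub>l l - p\<^sub>l l * r\<^sub>l l] (mod l ^ K)"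
      "[y2 = q\<^sub>l l + p\<^sub>l l * r\<^sub>l l] (mod l ^ K)" "[y3 = r\<^sub>l l - z * p\<^sub>l l * q\<^sub>l l] (mod l ^ K)"
      if l: "l \<in> S'" and z: "[m = z] (mod l ^ K)" for l z
    proof -
      have "[r * u = r\<^sub>l l * 1] (mod l ^ K)" "[q * u = q\<^sub>l l * 1] (mod l ^ K)"
        "[p * r = p\<^sub>l l * r\<^sub>l l] (mod l ^ K)" "[m * p * q = z * p\<^sub>l l * q\<^sub>l l] (mod l ^ K)"
        by (intro cong_mult lcong[OF l] z)+
      then show "[y0 = r\<^sub>l l + z * p\<^sub>l l * q\<^sub>l l] (mod l ^ K)" "[y1 = q\<^sub>l l - p\<^sub>l l * r\<^sub>l l] (mod l ^ K)"
        "[y2 = q\<^sub>l l + p\<^sub>l l * r\<^sub>l l] (mod l ^ K)" "[y3 = r\<^sub>l l - z * p\<^sub>l l * q\<^sub>l l] (mod l ^ K)"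
        unfolding y by (metis cong_add cong_diff mult.right_neutral)+
    qed
    have ya: "\<not> a dvd y0" "\<not> a dvd y1" "\<not> a dvd y2" "\<not> a dvd y3"
    proof -
      have "a \<in> S'" by (simp add: S'_def)
      from ycong[OF this cong_refl, THEN res_dvd]
      show "\<not> a dvd y0" "\<not> a dvd y1" "\<not> a dvd y2" "\<not> a dvd y3"
        using am a(1) not_prime_unit[of a] by (auto simp: p\<^sub>l_def q\<^sub>l_def r\<^sub>l_def)
    qed
    then have ynz: "y0 \<noteq> 0" "y1 \<noteq> 0" "y2 \<noteq> 0" "y3 \<noteq> 0" by auto
    have loc: "\<exists>e0 e1 e2 e3.
       v l A + 2 * v l y0 = v l 4 + v l c0 + e0 \<and>
       v l A + v l m + 2 * v l y1 = v l 4 + v l c1 + e1 \<and>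
       v l A + v l m + 2 * v l y2 = v l 4 + v l c2 + e2 \<and>
       v l A + 2 * v l y3 = v l 4 + e3 \<and>
       e0 \<noteq> 1 \<and> e1 \<noteq> 1 \<and> e2 \<noteq> 1 \<and> e3 \<noteq> 1 \<and> (e0 = 0 \<or> e1 = 0 \<or> e2 = 0)"
      if l: "prime l" for l
    proof -
      consider (a) "l = a" | (S) "l \<in> S" | (m) "l \<notin> S" "l \<noteq> a" "l dvd m" | (out) "l \<notin> S'"
        using l m0 by (auto simp: S'_def in_prime_factors_iff)
      then show ?thesis
      proof cases
        case a
        then show ?thesis using ya v0[OF am] vA[OF l] aS outS[OF l] v0 by simp
      next
        case out
        have out: "l \<notin> S" "\<not> l dvd m" using out l m0 by (auto simp: S'_def in_prime_factors_iff)
        \<comment> \<open>Here \<open>A\<close>, \<open>m\<close>, 4 and the coefficients are units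
          at \<open>l\<close>, so all valuations of the \<open>x\<close>-coordinates are even and
          only primitivity is at stake.\<close>
        have "\<not> (l dvd y0 \<and> l dvd y1 \<and> l dvd y2 \<and> l dvd y3)"
          using prime_dvd_quadric_point[OF l outS(6)[OF l out(1)] out(2) cop] y by blast
        \<comment> \<open>Primitivity concerns only the first three coordinates; the quadric
          transfers divisibility to the fourth.\<close>
        moreover have "l dvd y3" if "l dvd y0" "l dvd y1" "l dvd y2"
        proof -
          have "l dvd y0\<^sup>2 + m * y1\<^sup>2 - m * y2\<^sup>2" using that by (simp add: power2_eq_square)
          also have "\<dots> = y3\<^sup>2" unfolding y by (simp add: power2_eq_square algebra_simps)
          finally show ?thesis using l prime_dvd_power by blast
        qed
        ultimately have "v l y0 = 0 \<or> v l y1 = 0 \<or> v l y2 = 0"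
          using v0[of l y0] v0[of l y1] v0[of l y2] by metis
        moreover have "v l m = 0" using v0[OF out(2)] .
        ultimately show ?thesis
          using vA[OF l] out outS[OF l out(1)] by (intro valuation_witness) auto
      next
        case m
        then have "l \<in> S'" using l m0 by (auto simp: S'_def in_prime_factors_iff)
        note yc = ycong[OF this cong_refl, THEN res_dvd]
        \<comment> \<open>The units \<open>y0\<close> and \<open>y3\<close> give
          \<open>e0 = e3 = 0\<close>, while the factor \<open>l\<close> in \<open>y1\<close> and
          \<open>y2\<close> lifts \<open>e1\<close> and \<open>e2\<close> above 1 even if
          \<open>l\<close> divides \<open>m\<close> only once.\<close>
        have "\<not> l dvd y0" "\<not> l dvd y3" "l dvd y1" "l dvd y2"
          using yc m outS[OF l m(1)] not_prime_unit[of l] l by (auto simp: p\<^sub>l_def q\<^sub>l_def r\<^sub>l_def)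
        then have "v l y0 = 0" "v l y3 = 0" "v l y1 > 0" "v l y2 > 0"
          using v0 ynz prime_multiplicity_gt_zero_iff[OF prime_imp_prime_elem[OF l]] by (auto simp: v_def)
        then show ?thesis
          using vA[OF l] m outS[OF l m(1)] by (intro valuation_witness) auto
      next
        case S
        then have lS': "l \<in> S'" and la: "l \<noteq> a" using aS by (auto simp: S'_def)
        note yc = ycong[OF lS' m[OF S]]
        note KS = K[OF S] v4[OF l]
        have vm: "v l m = 0" using v0[OF mS[OF S]] .
        have zero: "K \<le> v l w" if "[w = 0] (mod l ^ K)" "w \<noteq> 0" for w
          unfolding v_def using l that by (rule multiplicity_ge_of_cong_0)
        have eq: "v l w = v l z" if "[w = z] (mod l ^ K)" "z \<noteq> 0" "v l z < K" for w z
          using l that unfolding v_def by (rule multiplicity_cong_prime_power)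
        have neg: "v l (- z) = v l z" for z
          using multiplicity_times_unit_right[of "-1" l z] by (simp add: v_def)
        have v1: "v l 1 = 0" "v l (-1) = 0" using neg[of 1] by (simp_all add: v_def)
        have v2: "v l (-2) = v l 2" using neg[of 2] by simp
        have vAl: "v l A = f l" using vA[OF l] S by simp
        consider (1) "v l c0 \<noteq> 1" | (2) "v l c0 = 1" "v l c1 \<noteq> 1"
          | (3) "v l c0 = 1" "v l c1 = 1" "v l c2 \<noteq> 1" | (4) "v l c0 = 1" "v l c1 = 1" "v l c2 = 1"
          by blast
        then show ?thesis
        proof cases
          case 1
          \<comment> \<open>Here \<open>e0 = 0\<close> and \<open>e3 = v l c0\<close>, which differs
            from 1 by the case assumption.\<close>
          have "[y0 = 1] (mod l ^ K)" "[y1 = 0] (mod l ^ K)" "[y2 = 0] (mod l ^ K)" "[y3 = 1] (mod l ^ K)"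
            using yc 1 la by (simp_all add: p\<^sub>l_def q\<^sub>l_def r\<^sub>l_def m\<^sub>l_def)
          then have "v l y0 = 0" "v l y3 = 0" "K \<le> v l y1" "K \<le> v l y2"
            using eq zero ynz v1 K5 by auto
          then show ?thesis using 1 KS vm vAl by (intro valuation_witness) (auto simp: f_def)
        next
          case 2
          \<comment> \<open>The squares of \<open>y1\<close> and \<open>y3\<close> now supply the 4,
            so \<open>f l\<close> omits \<open>v l 4\<close>. Then \<open>e1 = 0\<close> and
            \<open>e3 = v l c1\<close>.\<close>
          have "[y0 = 0] (mod l ^ K)" "[y1 = -2] (mod l ^ K)" "[y2 = 0] (mod l ^ K)" "[y3 = 2] (mod l ^ K)"
            using yc 2 la by (simp_all add: p\<^sub>l_def q\<^sub>l_def r\<^sub>l_def m\<^sub>l_def)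
          then have "v l y1 = v l 2" "v l y3 = v l 2" "K \<le> v l y0" "K \<le> v l y2"
            using eq[of y1 "-2"] eq[of y3 2] zero ynz v2 KS by auto
          then show ?thesis using 2 KS vm vAl by (intro valuation_witness) (auto simp: f_def)
        next
          case 3
          \<comment> \<open>With \<open>m = -1\<close> locally, \<open>y0\<close> vanishes and the
            terms in \<open>y2\<close> and \<open>y3\<close> cancel. Then \<open>e2 = 0\<close> and
            \<open>e3 = v l c2\<close>.\<close>
          have "[y0 = 0] (mod l ^ K)" "[y1 = 0] (mod l ^ K)" "[y2 = 2] (mod l ^ K)" "[y3 = 2] (mod l ^ K)"
            using yc 3 la by (simp_all add: p\<^sub>l_def q\<^sub>l_def r\<^sub>l_def m\<^sub>l_def)
          then have "v l y2 = v l 2" "v l y3 = v l 2" "K \<le> v l y0" "K \<le> v l y1"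
            using eq[of y2 2] eq[of y3 2] zero ynz v2 KS by auto
          then show ?thesis using 3 KS vm vAl by (intro valuation_witness) (auto simp: f_def)
        next
          case 4
          \<comment> \<open>The exponent \<open>v l 4 + 1\<close> matches both coefficients, so
            \<open>e1 = e2 = 0\<close>, and \<open>e0\<close>, \<open>e3\<close> are large.\<close>
          have "[y0 = 0] (mod l ^ K)" "[y1 = 1] (mod l ^ K)" "[y2 = 1] (mod l ^ K)" "[y3 = 0] (mod l ^ K)"
            using yc 4 la by (simp_all add: p\<^sub>l_def q\<^sub>l_def r\<^sub>l_def m\<^sub>l_def)
          then have "v l y1 = 0" "v l y2 = 0" "K \<le> v l y0" "K \<le> v l y3"
            using eq zero ynz v1 K5 by auto
          then show ?thesis using 4 KS vm vAl by (intro valuation_witness) (auto simp: f_def)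
        qed
      qed
    qed
    have quadric: "y0\<^sup>2 + m * y1\<^sup>2 - m * y2\<^sup>2 = y3\<^sup>2"
      unfolding y by (simp add: power2_eq_square algebra_simps)
    show ?thesis
      using campana_point_of_local_conditions[OF A m0 ynz nz quadric loc[unfolded v_def]]
      unfolding quadric_point.simps y by blast
  qed
  show ?thesis
  proof (rule that[OF A m0 M M30 _ _ fam])
    fix l :: int assume l: "prime l" "l dvd M"
    show "\<not> l dvd 1" using l not_prime_unit by blast
    have "l dvd q0 \<longleftrightarrow> l dvd q\<^sub>l l" "l dvd r0 \<longleftrightarrow> l dvd r\<^sub>l l"
      using res_dvd q0 r0 inS'[OF l] by blast+
    moreover have "\<not> (l dvd q\<^sub>l l \<and> l dvd r\<^sub>l l)"
      using l(1) not_prime_unit[of l] by (auto simp: q\<^sub>l_def r\<^sub>l_def)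
    moreover assume "l dvd q0"
    ultimately show "\<not> l dvd r0" by blast
  qed
qed

section \<open>From parameters to points of bounded height\<close>

text \<open>Sums and differences recover \<open>r u\<close>, \<open>p q\<close>, \<open>q u\<close>
  and \<open>p r\<close>; coprimality then recovers each parameter as a gcd, for example
  \<open>p = gcd (p * q) (p * r)\<close>.\<close>

lemma quadric_point_inj:
  fixes p q r u p' q' r' u' :: nat
  assumes "m \<noteq> 0" "coprime p u" "coprime q r" "coprime p' u'" "coprime q' r'"
    and eq: "quadric_point m (int p, int q, int r, int u) = quadric_point m (int p', int q', int r', int u')"
  shows "(p, q, r, u) = (p', q', r', u')"
proof -
  have "int r * int u + m * int p * int q = int r' * int u' + m * int p' * int q'"
    "int r * int u - m * int p * int q = int r' * int u' - m * int p' * int q'"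
    "int q * int u + int p * int r = int q' * int u' + int p' * int r'"
    "int q * int u - int p * int r = int q' * int u' - int p' * int r'"
    using eq by simp_all
  then have "int r * int u = int r' * int u'" "m * (int p * int q) = m * (int p' * int q')"
    "int q * int u = int q' * int u'" "int p * int r = int p' * int r'"
    unfolding mult.assoc by linarith+
  then have ru: "r * u = r' * u'" and pq: "p * q = p' * q'" and qu: "q * u = q' * u'" and pr: "p * r = p' * r'"
    using assms(1) by (simp_all flip: of_nat_mult)
  have g1: "gcd (a * b) (a * c) = a" if "coprime b c" for a b c :: nat
    using that by (simp add: gcd_mult_distrib_nat [symmetric])
  have g2: "gcd (b * a) (c * a) = a" if "coprime b c" for a b c :: nat
    using g1[OF that, of a] by (simp add: mult.commute)
  have "p = gcd (p * q) (p * r)" using g1[OF assms(3)] by simp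
  also have "\<dots> = p'" unfolding pq pr using g1[OF assms(5)] by simp
  finally have p: "p = p'" .
  have "u = gcd (q * u) (r * u)" using g2[OF assms(3)] by simp
  also have "\<dots> = u'" unfolding qu ru using g2[OF assms(5)] by simp
  finally have u: "u = u'" .
  have "q = gcd (p * q) (u * q)" using g2[OF assms(2)] by simp
  also have "\<dots> = gcd (p' * q') (u' * q')" using pq qu by (metis mult.commute)
  also have "\<dots> = q'" using g2[OF assms(4)] by simp
  finally have q: "q = q'" .
  have "r = gcd (p * r) (u * r)" using g2[OF assms(2)] by simp
  also have "\<dots> = gcd (p' * r') (u' * r')" using pr ru by (metis mult.commute)
  also have "\<dots> = r'" using g2[OF assms(4)] by simp
  finally have r: "r = r'" .
  show ?thesis using p q r u by simp
qed

lemma campana_lift_in_campana_points: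
  assumes lift: "campana_lift c0 c1 c2 A m (y0, y1, y2, y3) (x0, x1, x2, x3)"
    and nz: "c0 \<noteq> 0" "c1 \<noteq> 0" "c2 \<noteq> 0" "m \<noteq> 0"
    and Z: "\<bar>y0\<bar> \<le> Z" "\<bar>y1\<bar> \<le> Z" "\<bar>y2\<bar> \<le> Z" "\<bar>y3\<bar> \<le> Z"
    and B: "real_of_int (\<bar>A * m\<bar> * Z\<^sup>2) \<le> B"
  shows "(x0, x1, x2, x3) \<in> campana_points c0 c1 c2 B"
proof -
  have bd: "\<bar>x\<bar> \<le> \<bar>A * m\<bar> * Z\<^sup>2"
    if eq: "\<bar>4 * c * x\<bar> = \<bar>k\<bar> * y\<^sup>2" and c: "c \<noteq> 0" and k: "\<bar>k\<bar> \<le> \<bar>A * m\<bar>" and y: "\<bar>y\<bar> \<le> Z" for c x k y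
  proof -
    have "1 * \<bar>x\<bar> \<le> \<bar>4 * c\<bar> * \<bar>x\<bar>" using c by (intro mult_right_mono) auto
    also have "\<dots> = \<bar>k\<bar> * y\<^sup>2" using eq by (simp add: abs_mult)
    also have "\<dots> \<le> \<bar>A * m\<bar> * Z\<^sup>2"
      using k power_mono[OF y, of 2] by (intro mult_mono) auto
    finally show ?thesis by simp
  qed
  have A: "\<bar>A\<bar> \<le> \<bar>A * m\<bar>"
    using nz(4) mult_left_mono[of 1 "\<bar>m\<bar>" "\<bar>A\<bar>"] by (simp add: abs_mult)
  have L: "A * y0\<^sup>2 = 4 * c0 * x0" "A * m * y1\<^sup>2 = 4 * c1 * x1"
    "- (A * m * y2\<^sup>2) = 4 * c2 * x2" "A * y3\<^sup>2 = 4 * x3"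
    using lift by simp_all
  have "\<bar>4 * c0 * x0\<bar> = \<bar>A\<bar> * y0\<^sup>2" "\<bar>4 * c1 * x1\<bar> = \<bar>A * m\<bar> * y1\<^sup>2"
    "\<bar>4 * c2 * x2\<bar> = \<bar>A * m\<bar> * y2\<^sup>2" "\<bar>4 * 1 * x3\<bar> = \<bar>A\<bar> * y3\<^sup>2"
    using L by (simp_all add: abs_mult flip: L(1,2,3,4))
  then have "\<bar>x0\<bar> \<le> \<bar>A * m\<bar> * Z\<^sup>2" "\<bar>x1\<bar> \<le> \<bar>A * m\<bar> * Z\<^sup>2" "\<bar>x2\<bar> \<le> \<bar>A * m\<bar> * Z\<^sup>2" "\<bar>x3\<bar> \<le> \<bar>A * m\<bar> * Z\<^sup>2"
    using bd nz A Z by (metis order_refl zero_neq_one)+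
  then have "Max {\<bar>x0\<bar>, \<bar>x1\<bar>, \<bar>x2\<bar>, \<bar>x3\<bar>} \<le> \<bar>A * m\<bar> * Z\<^sup>2" by simp
  then have "real_of_int (Max {\<bar>x0\<bar>, \<bar>x1\<bar>, \<bar>x2\<bar>, \<bar>x3\<bar>}) \<le> B" using B by linarith
  moreover have "two_full x0" "two_full x1" "two_full x2" "two_full x3" "Gcd {x0, x1, x2} = 1"
    "c0 * x0 + c1 * x1 + c2 * x2 = x3"
    using lift by (simp_all only: campana_lift.simps)
  ultimately show ?thesis
    unfolding campana_points_def two_full_def by blast
qed

text \<open>The relation fixes the squares of the \<open>y\<close>-coordinates, so only the signs
  remain to be compared.\<close>

lemma campana_lift_eqD:
  assumes "campana_lift c0 c1 c2 A m (y0, y1, y2, y3) x" "campana_lift c0 c1 c2 A m (z0, z1, z2, z3) x"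
    and "A \<noteq> 0" "m \<noteq> 0"
    and sgn: "0 < y0 \<longleftrightarrow> 0 < z0" "0 < y1 \<longleftrightarrow> 0 < z1" "0 < y2 \<longleftrightarrow> 0 < z2" "0 < y3 \<longleftrightarrow> 0 < z3"
  shows "(y0, y1, y2, y3) = (z0, z1, z2, z3)"
proof -
  obtain x0 x1 x2 x3 where x: "x = (x0, x1, x2, x3)" by (cases x)
  have "A * y0\<^sup>2 = A * z0\<^sup>2" "A * m * y1\<^sup>2 = A * m * z1\<^sup>2" "A * m * y2\<^sup>2 = A * m * z2\<^sup>2" "A * y3\<^sup>2 = A * z3\<^sup>2"
    using assms(1,2) unfolding x campana_lift.simps by linarith+
  then have "y0\<^sup>2 = z0\<^sup>2" "y1\<^sup>2 = z1\<^sup>2" "y2\<^sup>2 = z2\<^sup>2" "y3\<^sup>2 = z3\<^sup>2" using assms(3,4) by simp_all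
  then have "\<bar>y0\<bar> = \<bar>z0\<bar>" "\<bar>y1\<bar> = \<bar>z1\<bar>" "\<bar>y2\<bar> = \<bar>z2\<bar>" "\<bar>y3\<bar> = \<bar>z3\<bar>"
    by (simp_all add: power2_eq_iff abs_eq_iff)
  then show ?thesis using sgn by auto
qed

text \<open>A parameter quadruple is recovered from its Campana point together with the four signs
  of the \<open>y\<close>-coordinates; the 16 sign patterns account for the constant.\<close>

lemma card_quads_le:
  assumes nz: "c0 \<noteq> 0" "c1 \<noteq> 0" "c2 \<noteq> 0" "A \<noteq> 0" "m \<noteq> 0"
    and lift: "\<And>p q r u. (p, q, r, u) \<in> quads N p0 q0 r0 u0 X \<Longrightarrow>
      \<exists>x. campana_lift c0 c1 c2 A m (quadric_point m (int p, int q, int r, int u)) x"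
    and B: "real_of_int (\<bar>A * m\<bar> * (1 + \<bar>m\<bar>)\<^sup>2) * (real X)\<^sup>2 \<le> B"
  shows "card (quads N p0 q0 r0 u0 X) \<le> 16 * card (campana_points c0 c1 c2 B)"
proof -
  let ?Q = "quads N p0 q0 r0 u0 X"
  define y where "y = (\<lambda>(p, q, r, u). quadric_point m (int p, int q, int r, int u))"
  define g where "g z = (SOME x. campana_lift c0 c1 c2 A m (y z) x)" for z
  have g: "campana_lift c0 c1 c2 A m (y z) (g z)" if "z \<in> ?Q" for z
  proof -
    obtain p q r u where z: "z = (p, q, r, u)" by (cases z)
    then have "\<exists>x. campana_lift c0 c1 c2 A m (y z) x" using lift that by (simp add: y_def)
    then show ?thesis unfolding g_def by (rule someI_ex)
  qed
  define sg :: "int \<times> int \<times> int \<times> int \<Rightarrow> _" where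
    "sg = (\<lambda>(y0, y1, y2, y3). (0 < y0, 0 < y1, 0 < y2, 0 < y3))"
  have "inj_on (\<lambda>z. (g z, sg (y z))) ?Q"
  proof (rule inj_onI)
    fix z z' assume z: "z \<in> ?Q" "z' \<in> ?Q" and eq: "(g z, sg (y z)) = (g z', sg (y z'))"
    obtain y0 y1 y2 y3 where yz: "y z = (y0, y1, y2, y3)" by (cases "y z")
    obtain z0 z1 z2 z3 where yz': "y z' = (z0, z1, z2, z3)" by (cases "y z'")
    have "(y0, y1, y2, y3) = (z0, z1, z2, z3)"
      using g[OF z(1)] g[OF z(2)] eq unfolding yz yz' sg_def
      by (intro campana_lift_eqD[of c0 c1 c2 A m _ _ _ _ "g z"] nz) auto
    then have yy: "y z = y z'" using yz yz' by simp
    obtain p q r u where p: "z = (p, q, r, u)" by (cases z)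
    obtain p' q' r' u' where p': "z' = (p', q', r', u')" by (cases z')
    show "z = z'" unfolding p p'
      using z yy nz unfolding p p' y_def
      by (intro quadric_point_inj[of m]) (auto simp: quads_def)
  qed
  moreover have "(\<lambda>z. (g z, sg (y z))) ` ?Q \<subseteq> campana_points c0 c1 c2 B \<times> UNIV"
  proof -
    have "g z \<in> campana_points c0 c1 c2 B" if z: "z \<in> ?Q" for z
    proof -
      obtain p q r u where p: "z = (p, q, r, u)" by (cases z)
      obtain x0 x1 x2 x3 where x: "g z = (x0, x1, x2, x3)" by (cases "g z")
      have le: "p * q \<le> X" "p * r \<le> X" "q * u \<le> X" "r * u \<le> X"
        using z by (auto simp: p quads_def)
      define P1 P2 P3 P4 where P: "P1 = int (p * q)" "P2 = int (p * r)" "P3 = int (q * u)" "P4 = int (r * u)"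
      have P': "0 \<le> P1" "P1 \<le> int X" "0 \<le> P2" "P2 \<le> int X" "0 \<le> P3" "P3 \<le> int X" "0 \<le> P4" "P4 \<le> int X"
        using le by (simp_all add: P del: of_nat_mult)
      have Z1: "\<bar>m * P1\<bar> \<le> \<bar>m\<bar> * int X"
        using P' by (simp add: abs_mult mult_left_mono)
      \<comment> \<open>As \<open>m\<close> is non-zero, the bound \<open>2 X\<close> for
        \<open>y2\<close> is covered by the common bound \<open>(1 + |m|) X\<close>.\<close>
      have Z2: "int X \<le> \<bar>m\<bar> * int X" using nz(5) mult_right_mono[of 1 "\<bar>m\<bar>" "int X"] by simp
      have eqs: "y z = (P4 + m * P1, P3 - P2, P3 + P2, P4 - m * P1)"
        by (simp add: y_def p P)
      have Zs: "\<bar>P4 + m * P1\<bar> \<le> (1 + \<bar>m\<bar>) * int X" "\<bar>P3 - P2\<bar> \<le> (1 + \<bar>m\<bar>) * int X"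
        "\<bar>P3 + P2\<bar> \<le> (1 + \<bar>m\<bar>) * int X" "\<bar>P4 - m * P1\<bar> \<le> (1 + \<bar>m\<bar>) * int X"
        using P' Z1 Z2 unfolding distrib_right mult_1 by linarith+
      have "real_of_int (\<bar>A * m\<bar> * ((1 + \<bar>m\<bar>) * int X)\<^sup>2) \<le> B"
        using B by (simp add: power_mult_distrib mult.assoc)
      then show ?thesis
        using campana_lift_in_campana_points[OF g[OF z, unfolded eqs x] nz(1-3,5) Zs] x by simp
    qed
    then show ?thesis by auto
  qed
  ultimately have "card ?Q \<le> card (campana_points c0 c1 c2 B \<times> (UNIV :: (bool \<times> bool \<times> bool \<times> bool) set))"
    using finite_campana_points by (intro card_inj_on_le) auto
  also have "\<dots> = card (campana_points c0 c1 c2 B) * 16"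
    by (simp add: card_cartesian_product flip: UNIV_Times_UNIV)
  finally show ?thesis by simp
qed

text \<open>Take \<open>Y\<close> of size \<open>sqrt (B / E)\<close> and \<open>n\<close> about
  \<open>log 2 (Y / W)\<close>. The threshold on \<open>B\<close> makes \<open>Y / W\<close> at
  least the fourth root of \<open>B\<close>, so \<open>Suc n >= ln B / 4\<close>; rounding gives
  \<open>Y^2 >= B / (4 E)\<close>. Together these yield \<open>16 E\<close>.\<close>

lemma exists_scale:
  fixes E B :: real and W :: nat
  assumes E: "E \<ge> 1" and W: "W \<ge> 1" and B: "B \<ge> E\<^sup>2 * (2 * real W) ^ 4"
  obtains Y n :: nat where "W * 2 ^ n \<le> Y" "E * (real Y)\<^sup>2 \<le> B"
    "B * ln B / (16 * E) \<le> real (Suc n) * (real Y)\<^sup>2"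
proof -
  \<comment> \<open>The factor 2 pays for rounding \<open>s\<close> down to \<open>Y\<close>: from
    \<open>Y >= s / 2\<close> follows \<open>Y / W >= s / w\<close>.\<close>
  define w where "w = 2 * real W"
  have w: "w \<ge> 2" using W by (simp add: w_def)
  have B': "E\<^sup>2 * w ^ 4 \<le> B" using B by (simp add: w_def)
  have w4: "w ^ 4 = (w\<^sup>2)\<^sup>2" by (simp flip: power_mult)
  have "1 * 1 \<le> E\<^sup>2 * w ^ 4" using E w by (intro mult_mono one_le_power) auto
  with B' have B1: "B \<ge> 1" by linarith
  define s where "s = sqrt (B / E)"
  have s2: "s\<^sup>2 = B / E" using B1 E by (simp add: s_def)
  have s0: "s \<ge> 0" using B1 E by (simp add: s_def)
  have sw: "sqrt (sqrt B) \<le> s / w"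
  proof -
    have "E * w\<^sup>2 \<le> sqrt B"
    proof (rule real_le_rsqrt)
      show "(E * w\<^sup>2)\<^sup>2 \<le> B" using B' by (simp only: power_mult_distrib w4)
    qed
    then have "sqrt B * (E * w\<^sup>2) \<le> sqrt B * sqrt B" using B1 by (intro mult_left_mono) auto
    then have "sqrt B \<le> B / (E * w\<^sup>2)" using B1 E w by (simp add: field_simps)
    also have "\<dots> = (s / w)\<^sup>2" by (simp add: power_divide s2)
    finally have "sqrt (sqrt B) \<le> sqrt ((s / w)\<^sup>2)" by (rule real_sqrt_le_mono)
    then show ?thesis using s0 w by simp
  qed
  have "1 \<le> sqrt (sqrt B)" using B1 by simp
  with sw have "1 \<le> s / w" by linarith
  then have s_w: "s \<ge> w" using w by (simp add: field_simps)
  define Y where "Y = nat \<lfloor>s\<rfloor>"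
  have Y: "real Y \<le> s" "real Y \<ge> s / 2"
    using s_w w s0 by (simp_all add: Y_def) linarith
  have YW: "real Y / real W \<ge> s / w"
    using divide_right_mono[OF Y(2), of "real W"] by (simp add: w_def)
  with \<open>1 \<le> s / w\<close> have YW1: "real Y / real W \<ge> 1" by linarith
  define n where "n = nat \<lfloor>log 2 (real Y / real W)\<rfloor>"
  have log0: "log 2 (real Y / real W) \<ge> 0" using YW1 by simp
  have n1: "real n \<le> log 2 (real Y / real W)" "log 2 (real Y / real W) \<le> real (Suc n)"
    using log0 by (simp_all add: n_def) linarith
  have "2 ^ n = 2 powr real n" by (simp add: powr_realpow)
  also have "\<dots> \<le> 2 powr (log 2 (real Y / real W))" using n1 by simp
  also have "\<dots> = real Y / real W" using YW1 by (intro powr_log_cancel) auto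
  finally have "real W * 2 ^ n \<le> real Y" using W by (simp add: field_simps)
  then have 1: "W * 2 ^ n \<le> Y" by (simp flip: of_nat_le_iff[where 'a = real])
  have "(real Y)\<^sup>2 \<le> s\<^sup>2" using Y by (intro power_mono) auto
  then have 2: "E * (real Y)\<^sup>2 \<le> B" using E by (simp add: s2 field_simps)
  have "ln B / 4 = ln (sqrt (sqrt B))" using B1 by (simp add: ln_sqrt)
  also have "\<dots> \<le> ln (real Y / real W)" using sw YW \<open>1 \<le> sqrt (sqrt B)\<close> by (intro ln_mono) auto
  also have "\<dots> \<le> ln (real Y / real W) / ln 2"
  proof -
    have "ln 2 * ln (real Y / real W) \<le> 1 * ln (real Y / real W)"
      using YW1 ln_le_minus_one[of "2::real"] by (intro mult_right_mono) auto
    then show ?thesis by (simp add: field_simps)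
  qed
  also have "\<dots> \<le> real (Suc n)" using n1(2) by (simp add: log_def)
  finally have ln: "ln B / 4 \<le> real (Suc n)" .
  have "(s / 2)\<^sup>2 \<le> (real Y)\<^sup>2" using Y s0 by (intro power_mono) auto
  then have "B / (4 * E) \<le> (real Y)\<^sup>2" by (simp add: power_divide s2 mult.commute)
  then have "ln B / 4 * (B / (4 * E)) \<le> real (Suc n) * (real Y)\<^sup>2"
    using ln B1 E by (intro mult_mono) auto
  then have "B * ln B / (16 * E) \<le> real (Suc n) * (real Y)\<^sup>2" by (simp add: mult_ac)
  with 1 2 that show ?thesis by blast
qed

theorem theorem1p2:
  fixes c0 c1 c2 :: int
  assumes "c0 \<noteq> 0" and "c1 \<noteq> 0" and "c2 \<noteq> 0"
  shows "\<exists>C>0. \<exists>B0. \<forall>B\<ge>B0. campana_count c0 c1 c2 B \<ge> C * (B * ln B)"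
proof (rule exists_campana_family[OF assms])
  fix A m M p0 q0 r0 u0 :: int
  assume nz: "A \<noteq> 0" "m \<noteq> 0" and M: "M > 0" "30 dvd M"
    and cop: "\<And>l. prime l \<Longrightarrow> l dvd M \<Longrightarrow> l dvd p0 \<Longrightarrow> \<not> l dvd u0"
      "\<And>l. prime l \<Longrightarrow> l dvd M \<Longrightarrow> l dvd q0 \<Longrightarrow> \<not> l dvd r0"
    and lift: "\<And>p q r u. [p = p0] (mod M) \<Longrightarrow> [q = q0] (mod M) \<Longrightarrow> [r = r0] (mod M) \<Longrightarrow> [u = u0] (mod M) \<Longrightarrow>
      coprime p u \<Longrightarrow> coprime q r \<Longrightarrow> \<exists>x. campana_lift c0 c1 c2 A m (quadric_point m (p, q, r, u)) x"
  define N where "N = nat M"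
  have N: "N > 0" "int N = M" using M by (auto simp: N_def)
  have N30: "30 dvd N" using M(2) unfolding N(2)[symmetric] by (metis int_dvd_int_iff of_nat_numeral)
  \<comment> \<open>The count runs over positive naturals, the local construction over integers;
    least non-negative residues modulo \<open>M\<close> connect the two.\<close>
  define res where "res x = nat (x mod M)" for x
  have res: "int (res x) = x mod M" "res x < N" for x
    using M(1) by (auto simp: res_def N_def nat_less_iff)
  have res_cong: "[int y = x] (mod M)" if "[y = res x] (mod N)" for x y
  proof -
    have "[int y = int (res x)] (mod int N)" using that by (simp only: cong_int_iff)
    then show ?thesis unfolding res(1) N(2) by (simp add: cong_def)
  qed
  have res_dvd: "l dvd res x \<longleftrightarrow> int l dvd x" if "l dvd N" for l x
  proof -
    have "int l dvd M" using that N(2) by (metis int_dvd_int_iff)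
    then have "int l dvd x mod M \<longleftrightarrow> int l dvd x" by (rule dvd_mod_iff)
    then show ?thesis unfolding res(1)[symmetric] by simp
  qed
  have dvd_N: "int l dvd M \<longleftrightarrow> l dvd N" for l unfolding N(2)[symmetric] by simp
  let ?Q = "quads N (res p0) (res q0) (res r0) (res u0)"
  define D where "D = real_of_int (\<bar>A * m\<bar> * (1 + \<bar>m\<bar>)\<^sup>2)"
  have "1 * 1 \<le> \<bar>A * m\<bar> * (1 + \<bar>m\<bar>)\<^sup>2"
  proof (rule mult_mono)
    have "A * m \<noteq> 0" using nz by simp
    then show "1 \<le> \<bar>A * m\<bar>" by linarith
  qed auto
  then have D: "D \<ge> 1" unfolding D_def by linarith
  \<comment> \<open>Chosen so that \<open>E * Y^2 = D * X^2\<close> for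
    \<open>X = 4 * N^2 * Y\<close>, the bound appearing in \<open>card_quads_ge\<close>.\<close>
  define E where "E = D * (4 * (real N)\<^sup>2)\<^sup>2"
  have "1 * 1 \<le> E" unfolding E_def
  proof (intro mult_mono one_le_power D)
    have "1 \<le> real N" using N(1) by simp
    then have "1 \<le> (real N)\<^sup>2" by (rule one_le_power)
    then show "1 \<le> 4 * (real N)\<^sup>2" by linarith
  qed (use D in auto)
  then have E: "E \<ge> 1" by simp
  define W where "W = (12 * N)\<^sup>2"
  have W: "W \<ge> 1" using N(1) by (simp add: W_def)
  \<comment> \<open>The constant collects 144 from the dyadic count, \<open>16 * E\<close> from the
    choice of scale, and 32 from the 16 sign patterns and the factor \<open>1 / 2\<close> in
    \<open>campana_count\<close>.\<close>
  have main: "1 / (32 * 144 * 16 * E) * (B * ln B) \<le> campana_count c0 c1 c2 B"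
    if B: "B \<ge> E\<^sup>2 * (2 * real W) ^ 4" for B
  proof -
    obtain Y n :: nat where Y: "W * 2 ^ n \<le> Y" "E * (real Y)\<^sup>2 \<le> B"
      "B * ln B / (16 * E) \<le> real (Suc n) * (real Y)\<^sup>2"
      using exists_scale[OF E W B] by blast
    have "real (Suc n) * (real Y)\<^sup>2 / 144 \<le> real (card (?Q (4 * N\<^sup>2 * Y)))"
    proof (rule card_quads_ge[OF N30 N(1) res(2) res(2) res(2) res(2)])
      show "(12 * N)\<^sup>2 * 2 ^ n \<le> Y" using Y(1) by (simp only: W_def)
      fix l :: nat assume l: "prime l" "l dvd N"
      have l': "prime (int l)" "int l dvd M" using l dvd_N by simp_all
      show "\<not> l dvd res u0" if "l dvd res p0" using that cop(1)[OF l'] res_dvd[OF l(2)] by simp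
      show "\<not> l dvd res r0" if "l dvd res q0" using that cop(2)[OF l'] res_dvd[OF l(2)] by simp
    qed
    also have "\<dots> \<le> 16 * real (card (campana_points c0 c1 c2 B))"
    proof -
      have "card (?Q (4 * N\<^sup>2 * Y)) \<le> 16 * card (campana_points c0 c1 c2 B)"
      proof (rule card_quads_le[OF assms nz])
        fix p q r u assume "(p, q, r, u) \<in> ?Q (4 * N\<^sup>2 * Y)"
        then have "[p = res p0] (mod N)" "[q = res q0] (mod N)" "[r = res r0] (mod N)" "[u = res u0] (mod N)"
          "coprime p u" "coprime q r" by (auto simp: quads_def)
        then show "\<exists>x. campana_lift c0 c1 c2 A m (quadric_point m (int p, int q, int r, int u)) x"
          by (intro lift res_cong) auto
      next
        have "D * (real (4 * N\<^sup>2 * Y))\<^sup>2 = E * (real Y)\<^sup>2" by (simp add: E_def power_mult_distrib)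
        then show "real_of_int (\<bar>A * m\<bar> * (1 + \<bar>m\<bar>)\<^sup>2) * (real (4 * N\<^sup>2 * Y))\<^sup>2 \<le> B"
          using Y(2) unfolding D_def by linarith
      qed
      then show ?thesis by linarith
    qed
    finally have "real (Suc n) * (real Y)\<^sup>2 \<le> 144 * 32 * campana_count c0 c1 c2 B"
      by (simp add: campana_count_def)
    with Y(3) have "B * ln B / (16 * E) \<le> 144 * 32 * campana_count c0 c1 c2 B" by linarith
    then show ?thesis using E by (simp add: field_simps)
  qed
  show ?thesis
    by (rule exI[of _ "1 / (32 * 144 * 16 * E)"], intro conjI exI[of _ "E\<^sup>2 * (2 * real W) ^ 4"] allI impI main)
       (use E in auto)
qed

end
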